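(* Let $G=(V,E)$ be a connected undirected graph with $N\ge 2$ nodes $v_1,\dots,v_N$, and let the states evolve by the average consensus update $$x_i[k+1]=x_i[k]+\varepsilon\sum_{v_j\in N_i}a_{ij}^{(k)}\,(x_j[k]-x_i[k]),\qquad k\ge 0,\ i=1,\dots,N,$$ where the coupling weights $a^{(k)}_{ij}$ are established according to the confidential interaction protocol and the admissible range $[\underline{a},\bar a]$ for the random selection of the $a_{i\to j}^{(k)}$ satisfies $0<\underline{a}<\bar a<\frac{1}{\sqrt{\varepsilon\Delta}}$. Let $\eta=\min\{1-\varepsilon\Delta\bar a^2,\ \varepsilon\underline{a}^2\}$ and $\alpha=\frac1N\sum_{j=1}^N x_j[0]$. Then the convergence rate is at least $\gamma=(1-\eta^{N-1})^{\frac{1}{N-1}}\in(0,1)$, meaning that there exists a positive constant $C$ such that $$\big\|\mathbf{x}[k]-\alpha\mathbf{1}\big\|\le C\gamma^k\qquad\text{for all }k\ge 0 .$$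
   Context: $N_i=\{v_j\in V:(v_i,v_j)\in E\}$ is the neighbor set of $v_i$ (no self-loops), $\Delta=\max_i|N_i|$, $\varepsilon>0$ is a constant step size, $x_i[k]\in\mathbb{R}$, $\mathbf{x}[k]=(x_1[k],\dots,x_N[k])^T$, $\mathbf{1}$ is the all-ones vector, and $\|\cdot\|$ is the Euclidean norm. Weights established by the confidential interaction protocol: for every edge $(v_i,v_j)\in E$ and every $k\ge 0$, $a_{ij}^{(k)}=a_{ji}^{(k)}=a_{i\to j}^{(k)}\,a_{j\to i}^{(k)}$, where $a_{i\to j}^{(k)}$ is chosen at random by node $v_i$ and $a_{j\to i}^{(k)}$ is chosen at random by node $v_j$. In the initial iteration $k=0$ each $a_{i\to j}^{(0)}$ is an arbitrary real number; for each $k\ge 1$ each $a_{i\to j}^{(k)}$ lies in the admissible range $[\underline a,\bar a]$ (with no restriction on its distribution there). The weights may vary arbitrarily with $k$ within these constraints, and the statement is for every realization of the weights and every initial state; $C$ may depend on the realization and on the initial state, but not on $k$. Encryption and quantization play no role: states are exact real numbers. *)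

theory Defs
  imports "HOL-Analysis.Analysis" "Graph_Theory.Digraph_Component"
begin

text \<open>
  An undirected graph without self-loops is a \<open>pair_graph\<close>: a finite, symmetric, loop-free set of
  pairs, each undirected edge being present in both orientations. The nodes \<open>v\<^sub>1, \<dots>, v\<^sub>N\<close> are the
  elements of a finite type \<open>'n\<close>, so that \<open>N = CARD('n)\<close> and a network state is a vector in
  \<open>real ^ 'n\<close>.
\<close>

definition neighbors :: "'a pair_pre_digraph \<Rightarrow> 'a \<Rightarrow> 'a set" where
  "neighbors G i = {j \<in> pverts G. (i, j) \<in> parcs G}"

definition max_degree :: "'a pair_pre_digraph \<Rightarrow> nat" where
  "max_degree G = (MAX i\<in>pverts G. card (neighbors G i))"

text \<open>
  \<open>w k i j\<close> is the factor that node \<open>i\<close> picks for its link to \<open>j\<close> at iteration \<open>k\<close>, and \<open>a k i j\<close>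
  the resulting coupling weight. The factors used at iteration 0 are arbitrary reals; only later
  ones must lie in the admissible range. Symmetry of \<open>a\<close> is a consequence of the product form.
\<close>

definition confidential_weights ::
  "'a pair_pre_digraph \<Rightarrow> real \<Rightarrow> real \<Rightarrow> (nat \<Rightarrow> 'a \<Rightarrow> 'a \<Rightarrow> real) \<Rightarrow> (nat \<Rightarrow> 'a \<Rightarrow> 'a \<Rightarrow> real) \<Rightarrow> bool"
where
  "confidential_weights G a_lo a_hi w a \<longleftrightarrow>
     (\<forall>k. \<forall>(i, j)\<in>parcs G. a k i j = w k i j * w k j i) \<and>
     (\<forall>k\<ge>1. \<forall>(i, j)\<in>parcs G. w k i j \<in> {a_lo..a_hi})"

definition consensus_update ::
  "'n pair_pre_digraph \<Rightarrow> real \<Rightarrow> (nat \<Rightarrow> 'n \<Rightarrow> 'n \<Rightarrow> real) \<Rightarrow> (nat \<Rightarrow> real ^ 'n) \<Rightarrow> bool"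
where
  "consensus_update G \<epsilon> a x \<longleftrightarrow>
     (\<forall>k i. x (Suc k) $ i = x k $ i + \<epsilon> * (\<Sum>j\<in>neighbors G i. a k i j * (x k $ j - x k $ i)))"

definition rate_eta :: "real \<Rightarrow> nat \<Rightarrow> real \<Rightarrow> real \<Rightarrow> real" where
  "rate_eta \<epsilon> \<Delta> a_lo a_hi = min (1 - \<epsilon> * real \<Delta> * a_hi\<^sup>2) (\<epsilon> * a_lo\<^sup>2)"

definition rate_gamma :: "nat \<Rightarrow> real \<Rightarrow> real" where
  "rate_gamma N \<eta> = (1 - \<eta> ^ (N - 1)) powr (1 / real (N - 1))"

end

theory Submission
  imports Defs
begin

text \<open>
  From iteration 1 on, every update replaces each state by a convex combination of the states in
  which the node itself and each of its neighbours carry weight at least \<open>\<eta>\<close>. In a connected graph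
  any node is reached from any other in \<open>N - 1\<close> possibly idle steps, so after that many iterations
  the minimal state has entered every state with weight at least \<open>\<eta> ^ (N - 1)\<close>: the spread between
  the largest and the smallest state has shrunk by the factor \<open>1 - \<eta> ^ (N - 1)\<close>. The weights are
  symmetric, so the average of the states is invariant, even under the unrestricted update at
  iteration 0, and the distance of every state to it is at most the spread.
\<close>

section \<open>Averaging steps and the spread of a state\<close>

text \<open>\<open>b\<close> is a row-stochastic matrix, bound existentially because it changes from
  step to step. The entry \<open>b i j\<close> is the weight that \<open>i\<close> gives to
  \<open>j\<close>, so influence runs against the arcs of \<open>E\<close>.\<close>

definition averaging_step ::
  "('a \<times> 'a) set \<Rightarrow> real \<Rightarrow> ('a::finite \<Rightarrow> real) \<Rightarrow> ('a \<Rightarrow> real) \<Rightarrow> bool"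
where
  "averaging_step E \<eta> x y \<longleftrightarrow>
     (\<exists>b. (\<forall>i j. 0 \<le> b i j) \<and> (\<forall>i. (\<Sum>j\<in>UNIV. b i j) = 1) \<and>
          (\<forall>i. y i = (\<Sum>j\<in>UNIV. b i j * x j)) \<and>
          (\<forall>i. \<eta> \<le> b i i) \<and> (\<forall>(i, j)\<in>E. \<eta> \<le> b i j))"

definition spread :: "('a::finite \<Rightarrow> real) \<Rightarrow> real" where
  "spread x = Max (range x) - Min (range x)"

lemma averaging_step_ge:
  assumes "averaging_step E \<eta> x y" "\<And>j. m \<le> x j"
  shows "m \<le> y i"
proof -
  obtain b where b: "\<And>i j. 0 \<le> b i j" "\<And>i. (\<Sum>j\<in>UNIV. b i j) = 1"
    "\<And>i. y i = (\<Sum>j\<in>UNIV. b i j * x j)"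
    using assms(1) unfolding averaging_step_def by blast
  have "m = (\<Sum>j\<in>UNIV. b i j * m)"
    using b(2)[of i] by (simp flip: sum_distrib_right)
  also have "\<dots> \<le> (\<Sum>j\<in>UNIV. b i j * x j)"
    by (intro sum_mono mult_left_mono assms(2) b(1))
  finally show ?thesis by (simp add: b(3))
qed

text \<open>Since the rows of \<open>b\<close> sum to 1, \<open>M - y i\<close> is the same convex
  combination of the nonnegative gaps \<open>M - x j\<close>, and any single term bounds it from
  below.\<close>

lemma averaging_step_gap:
  assumes "averaging_step E \<eta> x y" "\<And>j. x j \<le> M" "(i, j) \<in> E\<^sup>="
  shows "\<eta> * (M - x j) \<le> M - y i"
proof -
  obtain b where b: "\<And>i j. 0 \<le> b i j" "\<And>i. (\<Sum>j\<in>UNIV. b i j) = 1"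
    "\<And>i. y i = (\<Sum>j\<in>UNIV. b i j * x j)" "\<And>i. \<eta> \<le> b i i" "\<And>i j. (i, j) \<in> E \<Longrightarrow> \<eta> \<le> b i j"
    using assms(1) unfolding averaging_step_def by blast
  have nn: "0 \<le> M - x j" for j using assms(2)[of j] by simp
  have "\<eta> * (M - x j) \<le> b i j * (M - x j)"
    using assms(3) b(4,5) by (intro mult_right_mono nn) auto
  also have "\<dots> \<le> (\<Sum>j\<in>UNIV. b i j * (M - x j))"
    by (rule member_le_sum) (auto intro!: mult_nonneg_nonneg b(1) nn)
  also have "\<dots> = M - y i"
    using b(2)[of i]
    by (simp add: b(3) right_diff_distrib sum_subtractf flip: sum_distrib_right)
  finally show ?thesis .
qed

lemma averaging_step_le:
  assumes "averaging_step E \<eta> x y" "0 \<le> \<eta>" "\<And>j. x j \<le> M"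
  shows "y i \<le> M"
proof -
  have "0 \<le> \<eta> * (M - x i)" using assms(2) assms(3)[of i] by simp
  also have "\<dots> \<le> M - y i" by (rule averaging_step_gap[OF assms(1,3)]) simp
  finally show ?thesis by simp
qed

lemma spread_bounds:
  fixes x :: "'a::finite \<Rightarrow> real"
  shows "x i \<le> Max (range x)" "Min (range x) \<le> x i"
  by auto

lemma spread_nonneg: "0 \<le> spread x"
  using spread_bounds[of x undefined] unfolding spread_def by linarith

lemma spread_leI:
  assumes "\<And>i. x i \<le> u" "\<And>i. l \<le> x i"
  shows "spread x \<le> u - l"
proof -
  have "Max (range x) \<le> u" "l \<le> Min (range x)" using assms by auto
  then show ?thesis unfolding spread_def by linarith
qed

lemma spread_averaging_step:
  assumes "averaging_step E \<eta> x y" "0 \<le> \<eta>"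
  shows "spread y \<le> spread x"
  unfolding spread_def[of x]
  by (rule spread_leI; rule averaging_step_le[OF assms] averaging_step_ge[OF assms(1)])
     (auto simp: spread_bounds)

section \<open>Reachability in a fixed number of steps, and decay of the spread\<close>

text \<open>Idle steps make the sets reached from \<open>m\<close> increase with \<open>s\<close>. A
  nonempty set that stops growing is closed under \<open>E\<close>, hence under
  \<open>E\<^sup>*\<close>, hence everything; until then each step adds a node.\<close>

lemma relpow_reflcl_UNIV:
  fixes E :: "('a::finite \<times> 'a) set"
  assumes "E\<^sup>* = UNIV"
  shows "(E\<^sup>=) ^^ (CARD('a) - 1) = UNIV"
proof -
  have grow: "Suc s \<le> card (((E\<^sup>=) ^^ s) `` {m})" if "s < CARD('a)" for s and m :: 'a
    using that
  proof (induction s)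
    case 0
    then show ?case by simp
  next
    case (Suc s)
    let ?S = "((E\<^sup>=) ^^ s) `` {m}" and ?S' = "((E\<^sup>=) ^^ Suc s) `` {m}"
    have S': "?S' = (E\<^sup>=) `` ?S" by (simp only: relpow.simps relcomp_Image)
    have sub: "?S \<subseteq> ?S'" unfolding S' by blast
    show ?case
    proof (cases "?S = UNIV")
      case True
      with sub have "?S' = UNIV" by blast
      then show ?thesis using Suc.prems by simp
    next
      case False
      have "\<not> E `` ?S \<subseteq> ?S"
      proof
        assume "E `` ?S \<subseteq> ?S"
        then have "E\<^sup>* `` ?S = ?S" by (rule Image_closed_trancl)
        moreover have "?S \<noteq> {}" using Suc by auto
        ultimately show False using assms False by auto
      qed
      then have "?S \<subset> ?S'" using sub unfolding S' by blast
      then have "card ?S < card ?S'" by (intro psubset_card_mono) auto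
      then show ?thesis using Suc by simp
    qed
  qed
  have "((E\<^sup>=) ^^ (CARD('a) - 1)) `` {m} = UNIV" for m
  proof (rule card_seteq)
    have "0 < CARD('a)" by (simp add: card_gt_0_iff)
    then show "CARD('a) \<le> card (((E\<^sup>=) ^^ (CARD('a) - 1)) `` {m})"
      using grow[of "CARD('a) - 1" m] by simp
  qed auto
  then show ?thesis by auto
qed

text \<open>Along the path the gap below the fixed bound \<open>M\<close> loses at most a factor
  \<open>\<eta>\<close> per step.\<close>

lemma averaging_steps_gap:
  assumes step: "\<And>k. averaging_step E \<eta> (v k) (v (Suc k))" and "0 \<le> \<eta>" "sym E"
    and M: "\<And>j. v 0 j \<le> M"
    and path: "(j, i) \<in> (E\<^sup>=) ^^ s"
  shows "\<eta> ^ s * (M - v 0 j) \<le> M - v s i"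
  using path
proof (induction s arbitrary: i)
  case 0
  then show ?case by simp
next
  case (Suc s)
  have le: "v s j \<le> M" for s j
    by (induction s arbitrary: j) (auto intro: M averaging_step_le[OF step assms(2)])
  from Suc.prems obtain l where l: "(j, l) \<in> (E\<^sup>=) ^^ s" "(l, i) \<in> E\<^sup>=" by auto
  have "\<eta> ^ Suc s * (M - v 0 j) \<le> \<eta> * (M - v s l)"
    using mult_left_mono[OF Suc.IH[OF l(1)] assms(2)] by (simp add: mult.assoc)
  \<comment> \<open>The path provides the arc \<open>(l, i)\<close>, whereas \<open>i\<close>
    averaging over \<open>l\<close> requires \<open>(i, l)\<close>; symmetry of \<open>E\<close>
    turns it around.\<close>
  also have "\<dots> \<le> M - v (Suc s) i"
    using l(2) \<open>sym E\<close> by (intro averaging_step_gap[OF step] le) (auto dest: symD)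
  finally show ?case .
qed

text \<open>Only the upper end moves: the gap at a node attaining the minimum is the whole spread,
  and it pushes every state below \<open>?M\<close> by a share of that, while \<open>?m\<close>
  remains a lower bound.\<close>

lemma spread_contraction:
  fixes v :: "nat \<Rightarrow> 'a::finite \<Rightarrow> real"
  assumes step: "\<And>k. averaging_step E \<eta> (v k) (v (Suc k))" and "0 \<le> \<eta>" "sym E" "E\<^sup>* = UNIV"
  shows "spread (v (CARD('a) - 1)) \<le> (1 - \<eta> ^ (CARD('a) - 1)) * spread (v 0)"
proof -
  let ?T = "CARD('a) - 1" and ?M = "Max (range (v 0))" and ?m = "Min (range (v 0))"
  have "?m \<in> range (v 0)" by (rule Min_in) auto
  then obtain j where j: "v 0 j = ?m" by (metis rangeE)
  have ge: "?m \<le> v s i" for s i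
    by (induction s arbitrary: i) (auto intro: spread_bounds(2) averaging_step_ge[OF step])
  have le: "v ?T i \<le> ?M - \<eta> ^ ?T * (?M - ?m)" for i
    using averaging_steps_gap[where v = v, OF step assms(2,3), of ?M j i ?T] relpow_reflcl_UNIV[OF assms(4)]
    by (simp add: j spread_bounds)
  have "spread (v ?T) \<le> ?M - \<eta> ^ ?T * (?M - ?m) - ?m"
    by (rule spread_leI[OF le ge])
  then show ?thesis by (simp add: spread_def algebra_simps)
qed

text \<open>The contraction is iterated over blocks of length \<open>CARD('a) - 1\<close>; in the
  incomplete last block the spread merely does not grow, which costs the factor
  \<open>1 / \<gamma> ^ (CARD('a) - 1)\<close>.\<close>

lemma spread_decay:
  fixes v :: "nat \<Rightarrow> 'a::finite \<Rightarrow> real"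
  assumes step: "\<And>k. averaging_step E \<eta> (v k) (v (Suc k))" and "0 \<le> \<eta>" "sym E" "E\<^sup>* = UNIV"
    and card: "2 \<le> CARD('a)"
    and \<gamma>: "0 < \<gamma>" "\<gamma> \<le> 1" "\<gamma> ^ (CARD('a) - 1) = 1 - \<eta> ^ (CARD('a) - 1)"
  shows "spread (v k) \<le> spread (v 0) / \<gamma> ^ (CARD('a) - 1) * \<gamma> ^ k"
proof -
  let ?T = "CARD('a) - 1"
  have mono: "spread (v (k + r)) \<le> spread (v k)" for k r
    by (induction r) (auto intro: order_trans spread_averaging_step[OF step assms(2)])
  have mult: "spread (v (q * ?T)) \<le> (\<gamma> ^ ?T) ^ q * spread (v 0)" for q
  proof (induction q)
    case 0
    then show ?case by simp
  next
    case (Suc q)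
    have "spread (v (q * ?T + ?T)) \<le> \<gamma> ^ ?T * spread (v (q * ?T))"
      using spread_contraction[of E \<eta> "\<lambda>k. v (q * ?T + k)"] step assms(2-4)
      by (simp only: \<gamma>(3) add_Suc_right add_0_right)
    also have "\<dots> \<le> \<gamma> ^ ?T * ((\<gamma> ^ ?T) ^ q * spread (v 0))"
      using \<gamma>(1) by (intro mult_left_mono Suc.IH) simp
    finally show ?case by (simp add: add.commute mult.assoc)
  qed
  define q r where "q = k div ?T" and "r = k mod ?T"
  have k: "k = q * ?T + r"
    unfolding q_def r_def by (rule div_mult_mod_eq[symmetric])
  have r: "r \<le> ?T"
    using card by (simp add: r_def less_imp_le)
  have "spread (v k) \<le> spread (v 0) * \<gamma> ^ (q * ?T)"
  proof -
    have "(\<gamma> ^ ?T) ^ q = \<gamma> ^ (q * ?T)" by (metis power_mult mult.commute)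
    then show ?thesis
      using order_trans[OF mono mult, of q r] by (simp only: k mult.commute[of "spread (v 0)"])
  qed
  also have "\<dots> = spread (v 0) / \<gamma> ^ ?T * (\<gamma> ^ (q * ?T) * \<gamma> ^ ?T)"
    using \<gamma>(1) by simp
  \<comment> \<open>\<open>\<gamma> \<le> 1\<close> and \<open>r \<le> ?T\<close> give
    \<open>\<gamma> ^ ?T \<le> \<gamma> ^ r\<close>.\<close>
  also have "\<dots> \<le> spread (v 0) / \<gamma> ^ ?T * (\<gamma> ^ (q * ?T) * \<gamma> ^ r)"
    using \<gamma>(1,2) r
    by (intro mult_left_mono power_decreasing divide_nonneg_nonneg spread_nonneg) simp_all
  finally show ?thesis by (simp add: k power_add)
qed

section \<open>The network: distance to the average, connectivity, invariant sum, averaging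
  form\<close>

text \<open>An average lies between minimum and maximum, so each coordinate deviates by at most the
  spread; the factor \<open>CARD('n)\<close> comes from passing to the l1 norm. The vector
  \<open>1\<close> is componentwise, i.e. all ones.\<close>

lemma norm_diff_average_le:
  fixes y :: "real ^ 'n"
  assumes "c = (1 / real CARD('n)) * (\<Sum>j\<in>UNIV. y $ j)"
  shows "norm (y - c *\<^sub>R 1) \<le> real CARD('n) * spread (\<lambda>i. y $ i)"
proof -
  let ?y = "\<lambda>i. y $ i"
  have N: "0 < real CARD('n)" by simp
  have "(\<Sum>j\<in>UNIV. y $ j) \<le> real CARD('n) * Max (range ?y)"
    using sum_bounded_above[of UNIV ?y "Max (range ?y)"] spread_bounds(1)[of ?y] by simp
  then have 1: "c \<le> Max (range ?y)"
    using N by (simp add: assms divide_le_eq mult.commute)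
  have "real CARD('n) * Min (range ?y) \<le> (\<Sum>j\<in>UNIV. y $ j)"
    using sum_bounded_below[of UNIV "Min (range ?y)" ?y] spread_bounds(2)[of ?y] by simp
  then have 2: "Min (range ?y) \<le> c"
    using N by (simp add: assms le_divide_eq mult.commute)
  have "norm (y - c *\<^sub>R 1) \<le> (\<Sum>i\<in>UNIV. \<bar>(y - c *\<^sub>R 1) $ i\<bar>)"
    by (rule norm_le_l1_cart)
  also have "\<dots> \<le> (\<Sum>i\<in>(UNIV::'n set). spread ?y)"
  proof (rule sum_mono)
    fix i :: 'n
    show "\<bar>(y - c *\<^sub>R 1) $ i\<bar> \<le> spread ?y"
      using 1 2 spread_bounds[of ?y i] unfolding spread_def abs_le_iff
      by (simp only: vector_minus_component vector_scaleR_component one_index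
          real_scaleR_def mult_1_right) linarith
  qed
  finally show ?thesis by simp
qed

text \<open>For digraphs \<open>connected\<close> refers to the symmetric closure; as every edge
  occurs in both orientations, it yields strong connectivity.\<close>

lemma connected_rtrancl_parcs:
  fixes G :: "'n::finite pair_pre_digraph"
  assumes "pair_graph G" "pverts G = UNIV" "Digraph_Component.connected (with_proj G)"
  shows "(parcs G)\<^sup>* = UNIV"
proof -
  interpret pair_graph G by fact
  have "symmetric (with_proj G)" by (rule sym_arcs)
  then have "strongly_connected (with_proj G)"
    using assms(3) by (rule symmetric_connected_imp_strongly_connected)
  then have "(u, v) \<in> (parcs G)\<^sup>*" for u v
    using assms(2) by (auto simp: strongly_connected_def reachable_def dest: rtrancl_on_rtranclI)
  then show ?thesis by auto
qed

text \<open>With symmetric weights the flow from \<open>j\<close> to \<open>i\<close> is the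
  negative of the flow from \<open>i\<close> to \<open>j\<close>, so the total change
  cancels.\<close>

lemma consensus_update_sum:
  assumes graph: "pair_graph G" "pverts G = UNIV"
    and a: "\<And>k i j. (i, j) \<in> parcs G \<Longrightarrow> a k i j = a k j i"
    and dynamics: "consensus_update G \<epsilon> a x"
  shows "(\<Sum>i\<in>UNIV. x k $ i) = (\<Sum>i\<in>UNIV. x 0 $ i)"
proof (induction k)
  case (Suc k)
  interpret pair_graph G by fact
  \<comment> \<open>Extension by zero off the arcs gives both sums the same index set, so that they
    can be swapped.\<close>
  define f where "f i j = (if (i, j) \<in> parcs G then a k i j * (x k $ j - x k $ i) else 0)" for i j
  have "f i j = - f j i" for i j
    using a[of i j k] arcs_symmetric[of i j] arcs_symmetric[of j i]
    by (auto simp: f_def algebra_simps)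
  then have "(\<Sum>i\<in>UNIV. \<Sum>j\<in>UNIV. f i j) = (\<Sum>i\<in>UNIV. \<Sum>j\<in>UNIV. - f j i)"
    by (intro sum.cong refl)
  also have "\<dots> = - (\<Sum>i\<in>UNIV. \<Sum>j\<in>UNIV. f j i)"
    by (simp add: sum_negf)
  also have "(\<Sum>i\<in>UNIV. \<Sum>j\<in>UNIV. f j i) = (\<Sum>i\<in>UNIV. \<Sum>j\<in>UNIV. f i j)"
    by (rule sum.swap)
  finally have 0: "(\<Sum>i\<in>UNIV. \<Sum>j\<in>UNIV. f i j) = 0" by simp
  have "x (Suc k) $ i = x k $ i + \<epsilon> * (\<Sum>j\<in>UNIV. f i j)" for i
    using dynamics graph(2)
    by (simp add: consensus_update_def f_def neighbors_def sum.If_cases)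
  then show ?case
    using 0 Suc by (simp add: sum.distrib flip: sum_distrib_left)
qed simp

text \<open>The two entries of the minimum in \<open>rate_eta\<close> bound the two kinds of weight:
  the first the self-weight \<open>1 - s i\<close>, the second the weight of a neighbor.\<close>

lemma consensus_update_averaging_step:
  fixes G :: "'a::finite pair_pre_digraph"
  assumes graph: "pair_graph G" "pverts G = UNIV"
    and pos: "0 \<le> \<epsilon>" "0 \<le> a_lo"
    and weights: "confidential_weights G a_lo a_hi w a"
    and dynamics: "consensus_update G \<epsilon> a x"
    and lt: "\<epsilon> * real (max_degree G) * a_hi\<^sup>2 \<le> 1"
    and k: "1 \<le> k"
  shows "averaging_step (parcs G) (rate_eta \<epsilon> (max_degree G) a_lo a_hi)
    (\<lambda>i. x k $ i) (\<lambda>i. x (Suc k) $ i)"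
proof -
  interpret pair_graph G by fact
  let ?\<eta> = "rate_eta \<epsilon> (max_degree G) a_lo a_hi"
  have nb: "j \<in> neighbors G i \<longleftrightarrow> (i, j) \<in> parcs G" for i j
    using graph(2) by (auto simp: neighbors_def)
  have irr: "i \<notin> neighbors G i" for i
    unfolding nb using no_loops by force
  have "a k i j = w k i j * w k j i" "w k i j \<in> {a_lo..a_hi}" "w k j i \<in> {a_lo..a_hi}"
    if "(i, j) \<in> parcs G" for i j
    using that arcs_symmetric[OF that] k weights unfolding confidential_weights_def by auto
  then have a: "a_lo\<^sup>2 \<le> a k i j" "a k i j \<le> a_hi\<^sup>2" if "(i, j) \<in> parcs G" for i j
    using that pos by (force simp: power2_eq_square intro!: mult_mono)+
  define s where "s i = (\<Sum>j\<in>neighbors G i. \<epsilon> * a k i j)" for i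
  have s: "s i \<le> \<epsilon> * real (max_degree G) * a_hi\<^sup>2" for i
  proof -
    have "s i \<le> real (card (neighbors G i)) * (\<epsilon> * a_hi\<^sup>2)"
      unfolding s_def by (rule sum_bounded_above) (auto simp: nb intro!: mult_left_mono a pos)
    also have "\<dots> \<le> real (max_degree G) * (\<epsilon> * a_hi\<^sup>2)"
      using pos unfolding max_degree_def graph(2)
      by (intro mult_right_mono) auto
    finally show ?thesis by (simp add: mult_ac)
  qed
  define b where "b i j = (if j \<in> neighbors G i then \<epsilon> * a k i j else if j = i then 1 - s i else 0)"
    for i j
  \<comment> \<open>Used twice: \<open>f = 1\<close> gives the row sums, \<open>f\<close> the state
    gives the update.\<close>
  have sum_b: "(\<Sum>j\<in>UNIV. b i j * f j) =
      (1 - s i) * f i + (\<Sum>j\<in>neighbors G i. \<epsilon> * a k i j * f j)" for i and f :: "'a \<Rightarrow> real"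
  proof -
    have "b i j * f j = (if j = i then (1 - s i) * f j else 0)
        + (if j \<in> neighbors G i then \<epsilon> * a k i j * f j else 0)" for j
      using irr[of i] by (auto simp: b_def)
    then show ?thesis by (simp add: sum.distrib sum.If_cases)
  qed
  have diag: "?\<eta> \<le> 1 - s i" "0 \<le> 1 - s i" for i
    using s[of i] lt by (auto simp: rate_eta_def)
  have edge: "?\<eta> \<le> \<epsilon> * a k i j" "0 \<le> \<epsilon> * a k i j" if "(i, j) \<in> parcs G" for i j
    using mult_left_mono[OF a(1)[OF that] pos(1)] mult_nonneg_nonneg[OF pos(1) zero_le_power2[of a_lo]]
    by (auto simp: rate_eta_def)
  show ?thesis
    unfolding averaging_step_def
  proof (intro exI[of _ b] conjI allI)
    show "0 \<le> b i j" for i j using diag edge by (simp add: b_def nb)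
    show "(\<Sum>j\<in>UNIV. b i j) = 1" for i using sum_b[of i "\<lambda>_. 1"] by (simp add: s_def)
    show "?\<eta> \<le> b i i" for i using diag irr by (simp add: b_def)
    show "\<forall>(i, j)\<in>parcs G. ?\<eta> \<le> b i j" using edge by (auto simp: b_def nb)
    show "x (Suc k) $ i = (\<Sum>j\<in>UNIV. b i j * x k $ j)" for i
      using dynamics unfolding sum_b s_def consensus_update_def
      by (simp add: algebra_simps sum_distrib_left sum_subtractf)
  qed
qed

section \<open>The rate and the constant\<close>

theorem theorem2:
  fixes G :: "'n::finite pair_pre_digraph"
    and \<epsilon> a_lo a_hi \<eta> \<gamma> \<alpha> :: real
    and w a :: "nat \<Rightarrow> 'n \<Rightarrow> 'n \<Rightarrow> real"
    and x :: "nat \<Rightarrow> real ^ 'n"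
  assumes graph: "pair_graph G" "pverts G = (UNIV :: 'n set)"
    and conn: "Digraph_Component.connected (with_proj G)"
    and card: "CARD('n) \<ge> 2"
    and step: "\<epsilon> > 0"
    and range: "0 < a_lo" "a_lo < a_hi" "a_hi < 1 / sqrt (\<epsilon> * real (max_degree G))"
    and weights: "confidential_weights G a_lo a_hi w a"
    and dynamics: "consensus_update G \<epsilon> a x"
    and eta: "\<eta> = rate_eta \<epsilon> (max_degree G) a_lo a_hi"
    and gamma: "\<gamma> = rate_gamma CARD('n) \<eta>"
    and alpha: "\<alpha> = (1 / real CARD('n)) * (\<Sum>j\<in>UNIV. x 0 $ j)"
  shows "0 < \<gamma> \<and> \<gamma> < 1 \<and> (\<exists>C>0. \<forall>k. norm (x k - \<alpha> *\<^sub>R (1 :: real ^ 'n)) \<le> C * \<gamma> ^ k)"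
proof -
  interpret pair_graph G by fact
  let ?T = "CARD('n) - 1" and ?d = "real (max_degree G)"
  \<comment> \<open>Division by zero yields 0, so with \<open>?d = 0\<close> the upper bound on
    \<open>a_hi\<close> would read \<open>a_hi < 0\<close>; the admissible range thus forces a
    positive degree.\<close>
  have d: "0 < \<epsilon> * ?d"
  proof (rule ccontr)
    assume "\<not> 0 < \<epsilon> * ?d"
    then have "1 / sqrt (\<epsilon> * ?d) \<le> 0" by simp
    then show False using range by linarith
  qed
  have hi: "\<epsilon> * ?d * a_hi\<^sup>2 < 1"
  proof -
    from d have "a_hi * sqrt (\<epsilon> * ?d) < 1"
      using range(3) by (simp add: field_simps)
    moreover have "0 \<le> a_hi * sqrt (\<epsilon> * ?d)" using range d by simp
    ultimately have "(a_hi * sqrt (\<epsilon> * ?d))\<^sup>2 < 1" by (simp add: power_less_one_iff)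
    then show ?thesis using d by (simp add: power_mult_distrib mult_ac)
  qed
  have T: "0 < ?T" using card by simp
  have deg: "1 \<le> ?d"
    using d step by (simp add: zero_less_mult_iff)
  have "\<epsilon> * a_lo\<^sup>2 < \<epsilon> * a_hi\<^sup>2"
    using range step by (simp add: power_strict_mono)
  also have "\<dots> \<le> \<epsilon> * ?d * a_hi\<^sup>2"
    using deg step by (simp add: mult_right_mono)
  finally have "\<eta> < 1" using hi by (simp add: eta rate_eta_def)
  moreover have "0 < \<eta>" using hi range step by (simp add: eta rate_eta_def)
  ultimately have \<eta>: "0 < \<eta>" "\<eta> ^ ?T < 1" "0 < \<eta> ^ ?T"
    using T by (auto simp: power_less_one_iff)
  have \<gamma>_pos: "0 < \<gamma>"
    using \<eta> by (simp add: gamma rate_gamma_def)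
  have \<gamma>_pow: "\<gamma> ^ ?T = 1 - \<eta> ^ ?T"
  proof -
    have "\<gamma> ^ ?T = \<gamma> powr real ?T" using \<gamma>_pos by (rule powr_realpow[symmetric])
    also have "\<dots> = (1 - \<eta> ^ ?T) powr (1 / real ?T * real ?T)"
      unfolding gamma rate_gamma_def by (rule powr_powr)
    also have "1 / real ?T * real ?T = 1" using T
      by (intro nonzero_eq_divide_eq[THEN iffD1] refl) simp
    finally show ?thesis using \<eta> by simp
  qed
  \<comment> \<open>Otherwise \<open>\<gamma> ^ ?T\<close> would be at least 1.\<close>
  have "\<gamma> < 1"
    using \<gamma>_pow \<eta>(3) one_le_power[of \<gamma> ?T] by linarith
  with \<gamma>_pos have \<gamma>: "0 < \<gamma>" "\<gamma> < 1" by auto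
  let ?V = "\<lambda>k. spread (\<lambda>i. x k $ i)"
  \<comment> \<open>The sequence is shifted by one, since the factors lie in the admissible range
    only from iteration 1 on.\<close>
  have stepk: "averaging_step (parcs G) \<eta> (\<lambda>i. x (Suc k) $ i) (\<lambda>i. x (Suc (Suc k)) $ i)" for k
    unfolding eta using step range hi
    by (intro consensus_update_averaging_step[OF graph _ _ weights dynamics]) auto
  have "sym (parcs G)" using arcs_symmetric by (auto intro: symI)
  then have decay: "?V (Suc k) \<le> ?V 1 / \<gamma> ^ ?T * \<gamma> ^ k" for k
    using spread_decay[of "parcs G" \<eta> "\<lambda>k i. x (Suc k) $ i" \<gamma> k]
      stepk \<eta> \<gamma> \<gamma>_pow card connected_rtrancl_parcs[OF graph conn] by simp
  \<comment> \<open>\<open>?V 0\<close> covers \<open>k = 0\<close>; the last division by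
    \<open>\<gamma>\<close> makes up for the decay starting at iteration 1.\<close>
  define B where "B = ?V 0 + ?V 1 / \<gamma> ^ ?T / \<gamma>"
  have B: "?V k \<le> B * \<gamma> ^ k" for k
  proof (cases k)
    case 0
    then show ?thesis using \<gamma> by (simp add: B_def spread_nonneg)
  next
    case (Suc m)
    have "?V k \<le> ?V 1 / \<gamma> ^ ?T / \<gamma> * \<gamma> ^ k" using decay[of m] \<gamma> by (simp add: Suc)
    also have "\<dots> \<le> B * \<gamma> ^ k"
      using \<gamma> by (intro mult_right_mono) (simp_all add: B_def spread_nonneg)
    finally show ?thesis .
  qed
  have "0 \<le> B" using \<gamma> by (simp add: B_def spread_nonneg)
  \<comment> \<open>\<open>B\<close> vanishes if the spread is 0 at iterations 0 and 1; adding 1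
    keeps the constant positive.\<close>
  then have C: "0 < real CARD('n) * B + 1" by (simp add: add_nonneg_pos)
  have "a k i j = a k j i" if "(i, j) \<in> parcs G" for k i j
  proof -
    have "a k i j = w k i j * w k j i" "a k j i = w k j i * w k i j"
      using that arcs_symmetric[OF that] weights unfolding confidential_weights_def by blast+
    then show ?thesis by simp
  qed
  then have sum_eq: "(\<Sum>j\<in>UNIV. x k $ j) = (\<Sum>j\<in>UNIV. x 0 $ j)" for k
    by (rule consensus_update_sum[OF graph _ dynamics])
  have avg: "\<alpha> = (1 / real CARD('n)) * (\<Sum>j\<in>UNIV. x k $ j)" for k
    unfolding alpha sum_eq[of k] ..
  have "norm (x k - \<alpha> *\<^sub>R 1) \<le> (real CARD('n) * B + 1) * \<gamma> ^ k" for k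
  proof -
    have "norm (x k - \<alpha> *\<^sub>R 1) \<le> real CARD('n) * ?V k"
      by (rule norm_diff_average_le[OF avg])
    also have "\<dots> \<le> real CARD('n) * (B * \<gamma> ^ k)" by (intro mult_left_mono B) simp
    also have "\<dots> \<le> (real CARD('n) * B + 1) * \<gamma> ^ k" using \<gamma> by (simp add: algebra_simps)
    finally show ?thesis .
  qed
  with \<gamma> C show ?thesis by blast
qed

end
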